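(* Let $W$ be a mixing matrix satisfying the assumption on $W$ stated in the context, let $\gamma\in(0,1]$, let $\mathcal R$ be a retraction on $\mathcal M$ with associated constant $M_1>0$ (see context), and let $\{x_{i,k}\}$ be generated by $$x_{i,k+1}=\mathcal R_{x_{i,k}}\Big(-\gamma\,\mathcal P_{T_{x_{i,k}}\mathcal M}\Big(x_{i,k}-\sum_{j=1}^n W_{ij}x_{j,k}\Big)\Big),\qquad i=1,\dots,n,\ k\ge 0.$$ Suppose that $\mathbf x_0\in\mathcal N(\hat\delta)$ with $$\hat\delta\in\Big[0,\ \min\Big\{\frac{8M_1\gamma^2R+1-\sqrt{(8M_1\gamma^2R-1)^2+32M_1\gamma^2R(1-\gamma+\gamma\sigma_2)}}{16M_1\gamma^2},\ \frac R4\Big\}\Big).$$ Then $\{\mathbf x_k\}$ converges to the consensus set linearly with rate $$\rho_2:=\frac{R(1-\gamma+\gamma\sigma_2)}{R-\hat\delta}+8M_1\gamma^2\hat\delta<1.$$ More specifically, for any $k\ge 0$, $$\|\mathbf x_{k+1}-\bar{\mathbf x}_{k+1}\|\le\rho_2\|\mathbf x_k-\bar{\mathbf x}_k\|.$$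
   Context: $\mathcal M\subset\mathbb R^{d\times r}$ is a compact smooth embedded submanifold with the Euclidean metric, $T_x\mathcal M$ is its tangent space at $x$ and $\mathcal P_{T_x\mathcal M}$ the orthogonal projection onto it; $\|\cdot\|$ is the Euclidean (Frobenius) norm, $\mathrm{dist}(x,\mathcal M)=\inf_{y\in\mathcal M}\|y-x\|$, and $\mathcal P_{\mathcal M}(x)=\arg\min_{y\in\mathcal M}\|y-x\|$ is the nearest-point projection (any nearest point is taken where it is not unique). Throughout, $\mathcal M$ is $R$-proximally smooth for some $R>0$: $\mathcal P_{\mathcal M}(x)$ is a singleton whenever $\mathrm{dist}(x,\mathcal M)<R$. A known consequence is that for every $\tau\in(0,R)$, $\|\mathcal P_{\mathcal M}(x)-\mathcal P_{\mathcal M}(y)\|\le\frac{R}{R-\tau}\|x-y\|$ for all $x,y$ at distance at most $\tau$ from $\mathcal M$. Constant $M_1$: it is known that for any retraction $\mathcal R$ on $\mathcal M$ there is a constant $M_1>0$ such that $\|\mathcal P_{\mathcal M}(x+u)-\mathcal R_x(\mathcal P_{T_x\mathcal M}(u))\|\le M_1\|u\|^2$ for all $x\in\mathcal M$, $u\in\mathbb R^{d\times r}$; $M_1$ denotes such a constant. Assumption on $W\in\mathbb R^{n\times n}$ (the mixing matrix of an undirected network on $n$ agents, with $W_{ij}>0$ if $(i,j)$ is an edge and, for $i\neq j$, $W_{ij}=0$ otherwise): $W$ is doubly stochastic, with $W=W^\top$; $W_{ij}\ge 0$ and $0<W_{ii}<1$ for all $i,j$; the eigenvalues of $W$ lie in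 $(-1,1]$; and the second largest singular value $\sigma_2$ of $W$ lies in $[0,1)$. Notation: for $x_1,\dots,x_n\in\mathcal M$, $\mathbf x=[x_1^\top,\dots,x_n^\top]^\top\in\mathbb R^{nd\times r}$ (an element of $\mathcal M^n$), $\hat x=\frac1n\sum_i x_i$, $\bar x\in\mathcal P_{\mathcal M}(\hat x)$, and $\bar{\mathbf x}=[\bar x^\top,\dots,\bar x^\top]^\top$ ($n$ copies). With iteration index, $\mathbf x_k=[x_{1,k}^\top,\dots,x_{n,k}^\top]^\top$, with $\bar{\mathbf x}_k$ defined accordingly. The neighborhood is $\mathcal N(\delta)=\{\mathbf x\in\mathcal M^n:\|\mathbf x-\bar{\mathbf x}\|\le\delta\}$. The consensus set is $\{\mathbf x\in\mathcal M^n:x_1=\dots=x_n\}$. *)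

theory Defs
  imports "HOL-Analysis.Analysis"
begin

section \<open>Smooth maps and embedded submanifolds of a Euclidean space\<close>

(* Ck_on and smooth_on are meant for open S. *)
primrec Ck_on :: "nat \<Rightarrow> 'a::real_normed_vector set \<Rightarrow> ('a \<Rightarrow> 'b::real_normed_vector) \<Rightarrow> bool" where
  "Ck_on 0 S f \<longleftrightarrow> continuous_on S f"
| "Ck_on (Suc k) S f \<longleftrightarrow>
     (\<forall>x\<in>S. f differentiable (at x)) \<and> (\<forall>v. Ck_on k S (\<lambda>x. frechet_derivative f (at x) v))"

definition smooth_on :: "'a::real_normed_vector set \<Rightarrow> ('a \<Rightarrow> 'b::real_normed_vector) \<Rightarrow> bool" where
  "smooth_on S f \<longleftrightarrow> (\<forall>k. Ck_on k S f)"

(* Smoothness on a set that need not be open: local smooth extension to the ambient space. *)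
definition smooth_map_on :: "'a::real_normed_vector set \<Rightarrow> ('a \<Rightarrow> 'b::real_normed_vector) \<Rightarrow> bool" where
  "smooth_map_on S f \<longleftrightarrow>
     (\<forall>x\<in>S. \<exists>U g. open U \<and> x \<in> U \<and> smooth_on U g \<and> (\<forall>y\<in>U \<inter> S. g y = f y))"

(* Local slice condition: near each of its points, M is mapped onto an open piece of an
   m-dimensional linear subspace by a diffeomorphism between open sets of the ambient space. *)
definition embedded_submanifold :: "'a::euclidean_space set \<Rightarrow> bool" where
  "embedded_submanifold M \<longleftrightarrow>
     (\<exists>m. \<forall>x\<in>M. \<exists>U V \<phi> \<psi> L.
        open U \<and> x \<in> U \<and> open (V :: 'a set) \<and>
        homeomorphism U V \<phi> \<psi> \<and> smooth_on U \<phi> \<and> smooth_on V \<psi> \<and>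
        subspace L \<and> dim L = m \<and> \<phi> ` (U \<inter> M) = V \<inter> L)"

definition tangent_space :: "'a::euclidean_space set \<Rightarrow> 'a \<Rightarrow> 'a set" where
  "tangent_space M x =
     {v. \<exists>c \<epsilon>. 0 < \<epsilon> \<and> smooth_on {-\<epsilon><..<\<epsilon>} c \<and> c ` {-\<epsilon><..<\<epsilon>} \<subseteq> M \<and> c 0 = x \<and>
               (c has_vector_derivative v) (at (0::real))}"

definition tangent_bundle :: "'a::euclidean_space set \<Rightarrow> ('a \<times> 'a) set" where
  "tangent_bundle M = {(x, v). x \<in> M \<and> v \<in> tangent_space M x}"

(* Orthogonal projection onto the subspace T. *)
definition orth_proj :: "'a::euclidean_space set \<Rightarrow> 'a \<Rightarrow> 'a" where
  "orth_proj T u = (THE p. p \<in> T \<and> (\<forall>v\<in>T. orthogonal (u - p) v))"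

(* Rt x v is the retraction at x applied to the tangent vector v; its values for v outside
   tangent_space M x are irrelevant. *)
definition riemannian_retraction :: "'a::euclidean_space set \<Rightarrow> ('a \<Rightarrow> 'a \<Rightarrow> 'a) \<Rightarrow> bool" where
  "riemannian_retraction M Rt \<longleftrightarrow>
     smooth_map_on (tangent_bundle M) (\<lambda>(x, v). Rt x v) \<and>
     (\<forall>x\<in>M. (\<forall>v\<in>tangent_space M x. Rt x v \<in> M) \<and> Rt x 0 = x \<and>
            (Rt x has_derivative (\<lambda>v. v)) (at 0 within tangent_space M x))"

section \<open>Nearest-point projection\<close>

(* The set-valued projection argmin_{y \<in> M} |y - x|. *)
definition nearest_points :: "'a::metric_space set \<Rightarrow> 'a \<Rightarrow> 'a set" where
  "nearest_points M x = {y \<in> M. \<forall>z\<in>M. dist y x \<le> dist z x}"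

definition proximally_smooth :: "real \<Rightarrow> 'a::metric_space set \<Rightarrow> bool" where
  "proximally_smooth R M \<longleftrightarrow>
     0 < R \<and> (\<forall>x. infdist x M < R \<longrightarrow> (\<exists>p. nearest_points M x = {p}))"

(* Where x + u has several nearest points, the bound is only asked of one of them, so any
   constant that is valid for some choice of nearest points is admitted. *)
definition retraction_constant ::
    "'a::euclidean_space set \<Rightarrow> ('a \<Rightarrow> 'a \<Rightarrow> 'a) \<Rightarrow> real \<Rightarrow> bool" where
  "retraction_constant M Rt M1 \<longleftrightarrow>
     0 < M1 \<and>
     (\<forall>x\<in>M. \<forall>u. \<exists>p\<in>nearest_points M (x + u).
        norm (p - Rt x (orth_proj (tangent_space M x) u)) \<le> M1 * (norm u)\<^sup>2)"

section \<open>Mixing matrices\<close>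

definition eigenvalue :: "real^'n^'n \<Rightarrow> real \<Rightarrow> bool" where
  "eigenvalue A a \<longleftrightarrow> (\<exists>v. v \<noteq> 0 \<and> A *v v = a *\<^sub>R v)"

(* The square roots of the eigenvalues of A^T A in decreasing order, each repeated
   according to the dimension of its eigenspace. *)
definition singular_values :: "real^'n^'n \<Rightarrow> real list" where
  "singular_values A =
     concat (map (\<lambda>s. replicate (dim {v. (transpose A ** A) *v v = s\<^sup>2 *\<^sub>R v}) s)
       (rev (sorted_list_of_set {s. 0 \<le> s \<and> eigenvalue (transpose A ** A) (s\<^sup>2)})))"

(* The list is indexed from 0. *)
definition second_singular_value :: "real^'n^'n \<Rightarrow> real" where
  "second_singular_value A = singular_values A ! 1"

definition doubly_stochastic :: "real^'n^'n \<Rightarrow> bool" where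
  "doubly_stochastic W \<longleftrightarrow>
     (\<forall>i j. 0 \<le> W $ i $ j) \<and> (\<forall>i. (\<Sum>j\<in>UNIV. W $ i $ j) = 1) \<and> (\<forall>j. (\<Sum>i\<in>UNIV. W $ i $ j) = 1)"

(* E is the edge relation of the undirected network. *)
definition mixing_matrix :: "('n \<Rightarrow> 'n \<Rightarrow> bool) \<Rightarrow> real^'n^'n \<Rightarrow> bool" where
  "mixing_matrix E W \<longleftrightarrow>
     symp E \<and>
     (\<forall>i j. E i j \<longrightarrow> 0 < W $ i $ j) \<and>
     (\<forall>i j. i \<noteq> j \<and> \<not> E i j \<longrightarrow> W $ i $ j = 0) \<and>
     doubly_stochastic W \<and> transpose W = W \<and>
     (\<forall>i. 0 < W $ i $ i \<and> W $ i $ i < 1) \<and>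
     (\<forall>a. eigenvalue W a \<longrightarrow> -1 < a \<and> a \<le> 1) \<and>
     0 \<le> second_singular_value W \<and> second_singular_value W < 1"

section \<open>Stacked variables and consensus\<close>

(* A stacked variable is a vector indexed by the agents; its norm is the Frobenius norm of
   the stacked matrix. *)
definition agent_mean :: "'a::real_vector^'n \<Rightarrow> 'a" where
  "agent_mean x = (1 / real CARD('n)) *\<^sub>R (\<Sum>i\<in>UNIV. x $ i)"

definition stack :: "'a \<Rightarrow> 'a^'n" where
  "stack c = (\<chi> i. c)"

definition consensus_nbhd :: "'a::euclidean_space set \<Rightarrow> real \<Rightarrow> ('a^'n) set" where
  "consensus_nbhd M \<delta> =
     {x. (\<forall>i. x $ i \<in> M) \<and> (\<exists>c\<in>nearest_points M (agent_mean x). norm (x - stack c) \<le> \<delta>)}"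

definition consensus_set :: "'a set \<Rightarrow> ('a^'n) set" where
  "consensus_set M = {x. (\<forall>i. x $ i \<in> M) \<and> (\<forall>i j. x $ i = x $ j)}"

definition converges_linearly_to ::
    "(nat \<Rightarrow> 'a::metric_space) \<Rightarrow> 'a set \<Rightarrow> real \<Rightarrow> bool" where
  "converges_linearly_to x S \<rho> \<longleftrightarrow>
     (\<lambda>k. infdist (x k) S) \<longlonglongrightarrow> 0 \<and> (\<forall>k. infdist (x (Suc k)) S \<le> \<rho> * infdist (x k) S)"

end

theory Submission
  imports Defs
begin

text \<open>The consensus error of an iterate is \<open>norm (x - stack c)\<close>, with \<open>c\<close> the projection of the mean onto
  \<open>M\<close>.  Among all points of \<open>M\<close>, this \<open>c\<close> minimizes the error
  (\<open>nearest_point_minimizes_stacked\<close>).  So the error is the distance to the consensus set, and the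
  error of the next iterate can be estimated with the old \<open>c\<close> in place of the new one.

  Three facts then give the contraction in one step (\<open>retraction_step\<close>).  First, projecting onto a
  proximally smooth set is Lipschitz near the set, with constant \<open>R / (R - \<delta>)\<close> in the tube of radius
  \<open>\<delta>\<close> (\<open>nearest_points_lipschitz\<close>).  This rests on the fact that touching balls of every radius below
  \<open>R\<close> avoid the set, which follows from Brouwer's fixed-point theorem
  (\<open>proximally_smooth_ray_outward\<close>).  Second, one averaging step with weight \<open>\<gamma>\<close> shrinks the
  deviations from the mean by \<open>1 - \<gamma> + \<gamma> \<sigma>2\<close> (\<open>mix_contraction\<close>), since on vectors with zero sum
  the norm of \<open>W\<close> is at most its second singular value (\<open>doubly_stochastic_contraction\<close>).  Third, the
  retraction agrees with the projection up to an error that is quadratic in the length of the step,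
  hence quadratic in the consensus error, hence a small multiple of it in the neighbourhood.

  To apply the third fact the step size has to be moved through the projection onto the tangent space,
  which requires the tangent spaces of an embedded submanifold to be linear
  (\<open>tangent_space_subspace\<close>).  The bound on \<open>\<delta>\<close> keeps it below the root of a quadratic
  polynomial that separates rates below 1 from the others (\<open>rate_lt_1\<close>), so the neighbourhood is never left and the estimate can be iterated.\<close>

section \<open>Projection onto a proximally smooth set\<close>

lemma infdist_nearest_point:
  assumes "p \<in> nearest_points M x"
  shows "infdist x M = dist x p"
proof (rule antisym)
  have p: "p \<in> M" "\<And>z. z \<in> M \<Longrightarrow> dist p x \<le> dist z x"
    using assms by (auto simp: nearest_points_def)
  show "infdist x M \<le> dist x p"
    using p(1) by (rule infdist_le)
  have "M \<noteq> {}"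
    using p(1) by auto
  then show "dist x p \<le> infdist x M"
    using p(2) by (auto simp: infdist_notempty dist_commute intro!: cINF_greatest)
qed

text \<open>By the triangle inequality: a competitor closer to the intermediate point would also be closer
  to \<open>y\<close>.\<close>

lemma nearest_points_ray_inward:
  fixes p y :: "'a::real_normed_vector"
  assumes p: "p \<in> nearest_points M y" and s: "0 \<le> s" "s \<le> 1"
  shows "p \<in> nearest_points M (p + s *\<^sub>R (y - p))"
  unfolding nearest_points_def
proof (intro CollectI conjI ballI)
  show "p \<in> M" using p by (simp add: nearest_points_def)
  fix z assume "z \<in> M"
  then have "dist p y \<le> dist z y"
    using p by (simp add: nearest_points_def)
  moreover have "dist z y \<le> dist z (p + s *\<^sub>R (y - p)) + dist (p + s *\<^sub>R (y - p)) y"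
    by (rule dist_triangle)
  moreover have "dist (p + s *\<^sub>R (y - p)) y = (1 - s) * dist p y"
  proof -
    have "p + s *\<^sub>R (y - p) - y = (1 - s) *\<^sub>R (p - y)"
      by (simp add: algebra_simps)
    then show ?thesis
      using s by (simp add: dist_norm)
  qed
  moreover have "dist p (p + s *\<^sub>R (y - p)) = s * dist p y"
    using s by (simp add: dist_norm norm_minus_commute)
  ultimately show "dist p (p + s *\<^sub>R (y - p)) \<le> dist z (p + s *\<^sub>R (y - p))"
    by (simp add: algebra_simps)
qed

lemma proximally_smooth_unique:
  assumes "proximally_smooth R M" "infdist x M < R"
    and "p \<in> nearest_points M x" "q \<in> nearest_points M x"
  shows "p = q"
  using assms by (auto simp: proximally_smooth_def)

text \<open>Uniqueness makes the projection continuous: the graph of \<open>P\<close> over the closed tube is the set of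
  pairs \<open>(x, p)\<close> with \<open>p \<in> M\<close> and \<open>dist x p \<le> infdist x M\<close>, a closed set, and a map into a compact
  set with closed graph is continuous.\<close>

lemma proximally_smooth_obtains_projection:
  fixes M :: "'a::euclidean_space set"
  assumes prox: "proximally_smooth R M" and M: "compact M" 
  obtains P where "\<And>x. infdist x M < R \<Longrightarrow> P x \<in> nearest_points M x"
    and "\<And>d. d < R \<Longrightarrow> continuous_on {x. infdist x M \<le> d} P"
proof -
  define P where "P x = (SOME p. p \<in> nearest_points M x)" for x
  have P: "P x \<in> nearest_points M x" if "infdist x M < R" for x
    using prox that unfolding P_def proximally_smooth_def by (metis singletonI someI_ex)
  have "continuous_on {x. infdist x M \<le> d} P" if d: "d < R" for d
  proof (rule continuous_from_closed_graph[OF M])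
    show "P \<in> {x. infdist x M \<le> d} \<rightarrow> M"
      using P d by (force simp: nearest_points_def)
    have "(\<lambda>x. (x, P x)) ` {x. infdist x M \<le> d} =
      {xp. infdist (fst xp) M \<le> d} \<inter> (UNIV \<times> M) \<inter> {xp. dist (fst xp) (snd xp) \<le> infdist (fst xp) M}"
      (is "?l = ?r")
    proof (intro subset_antisym subsetI)
      fix xp assume "xp \<in> ?l"
      then obtain x where x: "xp = (x, P x)" "infdist x M \<le> d" by auto
      then have "P x \<in> nearest_points M x" using P d by auto
      then show "xp \<in> ?r"
        using x infdist_nearest_point[of "P x" M x] by (auto simp: nearest_points_def)
    next
      fix xp assume "xp \<in> ?r"
      then obtain x p where x: "xp = (x, p)" "infdist x M \<le> d" "p \<in> M" "dist x p \<le> infdist x M"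
        by (cases xp) auto
      have "p \<in> nearest_points M x"
        using x(3,4) infdist_le[of _ M x] unfolding nearest_points_def
        by (fastforce simp: dist_commute)
      then have "p = P x"
        using proximally_smooth_unique[OF prox] P[of x] x d by force
      then show "xp \<in> ?l" using x by auto
    qed
    moreover have "closed ?r"
      using compact_imp_closed[OF M]
      by (intro closed_Int closed_Times closed_Collect_le continuous_intros) auto
    ultimately show "closed (?l)" by simp
  qed
  with P that show ?thesis by blast
qed

text \<open>The nearest point \<open>p\<close> of \<open>z\<close> stays nearest when \<open>z\<close> is pushed away from \<open>p\<close> along the same ray, up
  to distance \<open>R\<close>.  Brouwer's theorem produces the pushed point without moving along the ray: with
  \<open>e = t - norm (z - p)\<close>, the map sending \<open>y\<close> to the point at distance \<open>e\<close> from \<open>z\<close> in the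
  direction away from \<open>P y\<close> is a continuous self-map of the ball \<open>cball z e\<close>.  At a fixed point \<open>y\<close>,
  the point \<open>z\<close> lies on the segment from \<open>P y\<close> to \<open>y\<close>, so that \<open>P y\<close> is nearest to \<open>z\<close> too and hence
  equals \<open>p\<close>; the fixed point is then the point sought.\<close>

lemma proximally_smooth_ray_outward:
  fixes M :: "'a::euclidean_space set"
  assumes prox: "proximally_smooth R M" and M: "compact M" 
    and p: "p \<in> nearest_points M z" and z: "z \<noteq> p" 
    and t: "norm (z - p) < t" "t < R"
  shows "p \<in> nearest_points M (p + (t / norm (z - p)) *\<^sub>R (z - p))"
proof -
  define d where "d = norm (z - p)"
  define e where "e = t - d"
  have d: "0 < d" "0 < e" "d + e = t" "infdist z M = d"
    using z t infdist_nearest_point[OF p] by (auto simp: d_def e_def dist_norm)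
  obtain P where P: "\<And>x. infdist x M < R \<Longrightarrow> P x \<in> nearest_points M x"
    and cont: "\<And>d. d < R \<Longrightarrow> continuous_on {x. infdist x M \<le> d} P"
    using proximally_smooth_obtains_projection[OF prox M] by metis
  have near: "infdist y M \<le> t" if "y \<in> cball z e" for y
    using infdist_triangle[of y M z] that d by (auto simp: dist_commute)
  have zM: "P y \<noteq> z" if "y \<in> cball z e" for y
    using P[of y] near[OF that] t(2) d infdist_zero[of z M] by (auto simp: nearest_points_def)
  define F where "F y = z + (e / norm (z - P y)) *\<^sub>R (z - P y)" for y
  have "continuous_on (cball z e) P"
    using cont[OF t(2)] near by (auto intro: continuous_on_subset)
  then have "continuous_on (cball z e) F"
    unfolding F_def by (intro continuous_intros ballI) (use zM in auto)
  moreover have "F \<in> cball z e \<rightarrow> cball z e"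
    using zM d by (auto simp: F_def dist_norm)
  ultimately obtain y where y: "y \<in> cball z e" "F y = y"
    using brouwer_ball[OF d(2)] by metis
  define q where "q = P y"
  define m where "m = norm (z - q)"
  have q: "q \<in> nearest_points M y"
    using P[of y] near[OF y(1)] t(2) by (auto simp: q_def)
  have m: "0 < m" using zM[OF y(1)] by (auto simp: m_def q_def)
  have yq: "y - q = ((m + e) / m) *\<^sub>R (z - q)"
  proof -
    have "y - q = (z - q) + (e / m) *\<^sub>R (z - q)"
      using y(2) by (simp add: F_def q_def m_def)
    also have "\<dots> = (1 + e / m) *\<^sub>R (z - q)" by (simp add: algebra_simps)
    finally show ?thesis using m by (simp add: add_divide_distrib)
  qed
  have "q + (m / (m + e)) *\<^sub>R (y - q) = z"
    using yq m d by simp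
  then have "q \<in> nearest_points M z"
    using nearest_points_ray_inward[OF q, of "m / (m + e)"] m d by simp
  then have "q = p"
    using proximally_smooth_unique[OF prox _ _ p] d t by auto
  then have "y = p + (t / d) *\<^sub>R (z - p)"
    using yq d by (simp add: m_def d_def algebra_simps)
  then show ?thesis
    using q \<open>q = p\<close> by (simp add: d_def)
qed

text \<open>The ball of every radius \<open>t < R\<close> that touches \<open>M\<close> at \<open>p\<close> and whose centre is on the ray from \<open>p\<close>
  through \<open>z\<close> has no point of \<open>M\<close> in its interior.  Expanding the square in
  \<open>norm (y - (p + t v)) \<ge> t\<close>, with \<open>v\<close> the unit direction of the ray, and letting \<open>t\<close> tend to \<open>R\<close>
  gives the inequality.\<close>

lemma proximal_normal_inequality:
  fixes M :: "'a::euclidean_space set"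
  assumes prox: "proximally_smooth R M" and M: "compact M" 
    and p: "p \<in> nearest_points M z" and z: "infdist z M < R" and y: "y \<in> M"
  shows "(z - p) \<bullet> (y - p) \<le> norm (z - p) * (norm (y - p))\<^sup>2 / (2 * R)"
proof (cases "z = p")
  case False
  define d where "d = norm (z - p)"
  have d: "0 < d" "d < R"
    using False infdist_nearest_point[OF p] z by (auto simp: d_def dist_norm)
  have bound: "2 * t * ((z - p) \<bullet> (y - p)) \<le> d * (norm (y - p))\<^sup>2" if t: "d < t" "t < R" for t
  proof -
    have "p \<in> nearest_points M (p + (t / d) *\<^sub>R (z - p))"
      using proximally_smooth_ray_outward[OF prox M p False] t unfolding d_def by auto
    then have "norm ((t / d) *\<^sub>R (z - p)) \<le> norm (y - p - (t / d) *\<^sub>R (z - p))"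
      using y by (simp add: nearest_points_def dist_norm flip: diff_diff_add)
    then have "(norm ((t / d) *\<^sub>R (z - p)))\<^sup>2 \<le> (norm (y - p - (t / d) *\<^sub>R (z - p)))\<^sup>2"
      by (rule power_mono) simp
    then have "2 * (((t / d) *\<^sub>R (z - p)) \<bullet> (y - p)) \<le> (norm (y - p))\<^sup>2"
      unfolding power2_norm_eq_inner inner_diff_left[of "y - p"] inner_diff_right[of _ "y - p"]
      by (simp add: inner_commute)
    then have "2 * (t / d) * ((z - p) \<bullet> (y - p)) \<le> (norm (y - p))\<^sup>2"
      by simp
    then show ?thesis
      using d by (simp add: field_simps)
  qed
  have "2 * R * ((z - p) \<bullet> (y - p)) \<le> d * (norm (y - p))\<^sup>2"
  proof (rule tendsto_upperbound)
    show "((\<lambda>t. 2 * t * ((z - p) \<bullet> (y - p))) \<longlongrightarrow> 2 * R * ((z - p) \<bullet> (y - p))) (at_left R)"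
      by (intro tendsto_intros)
    show "\<forall>\<^sub>F t in at_left R. 2 * t * ((z - p) \<bullet> (y - p)) \<le> d * (norm (y - p))\<^sup>2"
      using eventually_at_left_real[OF d(2)] by eventually_elim (auto intro: bound)
  qed simp
  moreover have "0 < 2 * R" using d by simp
  ultimately show ?thesis
    unfolding d_def by (subst pos_le_divide_eq) (simp_all add: mult.commute)
qed simp

text \<open>Adding the proximal normal inequality at \<open>p\<close> towards \<open>q\<close> and at \<open>q\<close> towards \<open>p\<close> bounds
  \<open>(1 - \<tau> / R) * (norm (p - q))\<^sup>2\<close> by \<open>(x - y) \<bullet> (p - q)\<close>, and the Cauchy-Schwarz inequality
  finishes.\<close>

lemma nearest_points_lipschitz:
  fixes M :: "'a::euclidean_space set"
  assumes prox: "proximally_smooth R M" and M: "compact M" 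
    and p: "p \<in> nearest_points M x" "q \<in> nearest_points M y"
    and \<tau>: "infdist x M \<le> \<tau>" "infdist y M \<le> \<tau>" "\<tau> < R"
  shows "norm (p - q) \<le> R / (R - \<tau>) * norm (x - y)"
proof -
  have R: "0 < R" using prox by (simp add: proximally_smooth_def)
  have pq: "p \<in> M" "q \<in> M" using p by (auto simp: nearest_points_def)
  have "(x - p) \<bullet> (q - p) \<le> norm (x - p) * (norm (p - q))\<^sup>2 / (2 * R)"
    using proximal_normal_inequality[OF prox M p(1) _ pq(2)] \<tau> by (simp add: norm_minus_commute)
  also have "\<dots> \<le> \<tau> * (norm (p - q))\<^sup>2 / (2 * R)"
    using R \<tau>(1) infdist_nearest_point[OF p(1)]
    by (intro divide_right_mono mult_right_mono) (auto simp: dist_norm)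
  finally have 1: "(x - p) \<bullet> (q - p) \<le> \<tau> * (norm (p - q))\<^sup>2 / (2 * R)" .
  have "(y - q) \<bullet> (p - q) \<le> norm (y - q) * (norm (p - q))\<^sup>2 / (2 * R)"
    using proximal_normal_inequality[OF prox M p(2) _ pq(1)] \<tau> by simp
  also have "\<dots> \<le> \<tau> * (norm (p - q))\<^sup>2 / (2 * R)"
    using R \<tau>(2) infdist_nearest_point[OF p(2)]
    by (intro divide_right_mono mult_right_mono) (auto simp: dist_norm)
  finally have "(x - p) \<bullet> (q - p) + (y - q) \<bullet> (p - q) \<le> \<tau> * (norm (p - q))\<^sup>2 / R"
    using 1 R by (simp add: field_simps)
  moreover have "(x - p) \<bullet> (q - p) + (y - q) \<bullet> (p - q) = (norm (p - q))\<^sup>2 - (x - y) \<bullet> (p - q)"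
    by (simp add: power2_norm_eq_inner inner_diff_left inner_diff_right inner_commute)
  moreover have "(x - y) \<bullet> (p - q) \<le> norm (x - y) * norm (p - q)"
    by (rule norm_cauchy_schwarz)
  ultimately have "(norm (p - q))\<^sup>2 \<le> \<tau> * (norm (p - q))\<^sup>2 / R + norm (x - y) * norm (p - q)"
    by linarith
  then have "(R - \<tau>) * norm (p - q) * norm (p - q) \<le> R * norm (x - y) * norm (p - q)"
    using R by (simp add: field_simps power2_eq_square)
  then have "norm (p - q) = 0 \<or> (R - \<tau>) * norm (p - q) \<le> R * norm (x - y)"
    by (metis mult_right_le_imp_le norm_ge_zero order_less_le)
  then show ?thesis
  proof
    assume "norm (p - q) = 0"
    then show ?thesis using R \<tau> by simp
  next
    assume "(R - \<tau>) * norm (p - q) \<le> R * norm (x - y)"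
    then show ?thesis using \<tau>(3) by (simp add: field_simps)
  qed
qed

section \<open>Tangent spaces of embedded submanifolds\<close>

lemma Ck_on_cong:
  assumes "open S" "\<And>x. x \<in> S \<Longrightarrow> f x = g x" "Ck_on k S f"
  shows "Ck_on k S g"
  using assms
proof (induction k arbitrary: f g)
  case 0
  then show ?case by (simp add: continuous_on_cong[of S S f g])
next
  case (Suc k)
  have diff: "f differentiable (at x)" if "x \<in> S" for x
    using Suc.prems(3) that by simp
  have "g differentiable (at x)" if "x \<in> S" for x
    using diff[OF that] Suc.prems(1,2) that
    by (meson differentiable_def has_derivative_transform_within_open)
  moreover have "Ck_on k S (\<lambda>x. frechet_derivative g (at x) v)" for v
  proof (rule Suc.IH[OF Suc.prems(1)])
    show "frechet_derivative f (at x) v = frechet_derivative g (at x) v" if "x \<in> S" for x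
      using frechet_derivative_transform_within_open[OF diff[OF that] Suc.prems(1) that Suc.prems(2)]
      by simp
    show "Ck_on k S (\<lambda>x. frechet_derivative f (at x) v)"
      using Suc.prems(3) by simp
  qed
  ultimately show ?case by simp
qed

text \<open>The directional derivatives of \<open>t \<mapsto> f (a + t l)\<close> have again the form \<open>t \<mapsto> g (a + t l)\<close>, with
  \<open>g x = frechet_derivative f (at x) (s l)\<close>.  Hence the induction closes without a general chain
  rule for higher derivatives.\<close>

lemma Ck_on_line:
  fixes f :: "'a::real_normed_vector \<Rightarrow> 'b::real_normed_vector"
  assumes "Ck_on k V f" "open I" "\<And>t::real. t \<in> I \<Longrightarrow> a + t *\<^sub>R l \<in> V"
  shows "Ck_on k I (\<lambda>t. f (a + t *\<^sub>R l))"
  using assms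
proof (induction k arbitrary: f)
  case 0
  then show ?case
    by (auto intro!: continuous_on_compose2[of V f] continuous_intros)
next
  case (Suc k)
  have der: "((\<lambda>t. f (a + t *\<^sub>R l)) has_derivative (\<lambda>s. frechet_derivative f (at (a + t *\<^sub>R l)) (s *\<^sub>R l))) (at t)"
    if "t \<in> I" for t
  proof -
    have "f differentiable (at (a + t *\<^sub>R l))"
      using Suc.prems that by simp
    then have 1: "(f has_derivative frechet_derivative f (at (a + t *\<^sub>R l))) (at (a + t *\<^sub>R l))"
      by (simp add: frechet_derivative_works)
    have 2: "((\<lambda>t. a + t *\<^sub>R l) has_derivative (\<lambda>s. s *\<^sub>R l)) (at t)"
      by (auto intro!: derivative_eq_intros)
    show ?thesis
      using has_derivative_compose[OF 2 1] .
  qed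
  then have "\<forall>t\<in>I. (\<lambda>t. f (a + t *\<^sub>R l)) differentiable (at t)"
    using differentiable_def by blast
  moreover have "Ck_on k I (\<lambda>t. frechet_derivative (\<lambda>t. f (a + t *\<^sub>R l)) (at t) s)" for s
  proof (rule Ck_on_cong[OF Suc.prems(2)])
    show "Ck_on k I (\<lambda>t. frechet_derivative f (at (a + t *\<^sub>R l)) (s *\<^sub>R l))"
      by (rule Suc.IH[OF _ Suc.prems(2,3)]) (use Suc.prems(1) in simp)
    show "frechet_derivative f (at (a + t *\<^sub>R l)) (s *\<^sub>R l)
        = frechet_derivative (\<lambda>t. f (a + t *\<^sub>R l)) (at t) s" if "t \<in> I" for t
      using frechet_derivative_at[OF der[OF that]] by metis
  qed
  ultimately show ?case by simp
qed

lemma smooth_on_imp_has_derivative: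
  assumes "smooth_on U f" "x \<in> U"
  shows "(f has_derivative frechet_derivative f (at x)) (at x)"
proof -
  have "Ck_on (Suc 0) U f" using assms(1) by (auto simp: smooth_on_def simp del: Ck_on.simps)
  then show ?thesis
    using assms(2) by (simp add: frechet_derivative_works)
qed

lemma has_vector_derivative_imp_tendsto_slope:
  assumes "(f has_vector_derivative v) (at t)"
  shows "((\<lambda>h. (f (t + h) - f t) /\<^sub>R h) \<longlongrightarrow> v) (at 0)"
proof -
  have lim: "((\<lambda>h. norm (f (t + h) - f t - h *\<^sub>R v) / norm h) \<longlongrightarrow> 0) (at 0)"
    using assms by (simp add: has_vector_derivative_def has_derivative_at)
  have "norm (f (t + h) - f t - h *\<^sub>R v) / norm h = norm ((f (t + h) - f t) /\<^sub>R h - v)"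
    if "h \<noteq> 0" for h
  proof -
    have "(f (t + h) - f t) /\<^sub>R h - v = (f (t + h) - f t - h *\<^sub>R v) /\<^sub>R h"
      using that by (simp add: scaleR_diff_right)
    then show ?thesis
      by (simp add: divide_inverse mult.commute)
  qed
  then have "\<forall>\<^sub>F h in at 0. norm (f (t + h) - f t - h *\<^sub>R v) / norm h
      = norm ((f (t + h) - f t) /\<^sub>R h - v)"
    by (auto simp: eventually_at_filter)
  then have "((\<lambda>h. norm ((f (t + h) - f t) /\<^sub>R h - v)) \<longlongrightarrow> 0) (at 0)"
    by (rule Lim_transform_eventually[OF lim])
  then show ?thesis
    by (rule LIM_zero_cancel[OF tendsto_norm_zero_cancel])
qed

text \<open>In a slice chart \<open>\<phi>\<close> with inverse \<open>\<psi>\<close> and slice \<open>L\<close>, the tangent space at \<open>x\<close> is the image of \<open>L\<close>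
  under the derivative of \<open>\<psi>\<close> at \<open>\<phi> x\<close>.  A curve in \<open>M\<close> is mapped by \<open>\<phi>\<close> into \<open>L\<close>, which is closed
  and so contains the velocity of the image; conversely \<open>\<psi>\<close> maps straight lines of \<open>L\<close> to curves in
  \<open>M\<close>.\<close>

lemma tangent_space_subspace:
  fixes M :: "'a::euclidean_space set"
  assumes "embedded_submanifold M" "x \<in> M"
  shows "subspace (tangent_space M x)"
proof -
  obtain U V \<phi> \<psi> L where U: "open U" "x \<in> U" "open (V :: 'a set)" "homeomorphism U V \<phi> \<psi>"
    and sm: "smooth_on U \<phi>" "smooth_on V \<psi>" and L: "subspace L" "\<phi> ` (U \<inter> M) = V \<inter> L"
    using assms unfolding embedded_submanifold_def
    by (elim exE) (drule (1) bspec, elim exE conjE, rule that)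
  define a where "a = \<phi> x"
  define D\<phi> where "D\<phi> = frechet_derivative \<phi> (at x)"
  define D\<psi> where "D\<psi> = frechet_derivative \<psi> (at a)"
  have inv: "\<And>y. y \<in> U \<Longrightarrow> \<psi> (\<phi> y) = y" "\<And>y. y \<in> U \<Longrightarrow> \<phi> y \<in> V"
    using U(4) by (auto simp: homeomorphism_def)
  have chart_mem: "\<psi> l \<in> M" if "l \<in> V \<inter> L" for l
  proof -
    have "l \<in> \<phi> ` (U \<inter> M)" using that L(2) by simp
    then show ?thesis using inv(1) by auto
  qed
  have a: "a \<in> V \<inter> L"
    using U(2) assms(2) L(2) by (auto simp: a_def)
  have der\<phi>: "(\<phi> has_derivative D\<phi>) (at x)"
    unfolding D\<phi>_def by (rule smooth_on_imp_has_derivative[OF sm(1) U(2)])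
  have der\<psi>: "(\<psi> has_derivative D\<psi>) (at a)"
    unfolding D\<psi>_def using a by (intro smooth_on_imp_has_derivative[OF sm(2)]) auto
  have inverse: "D\<psi> (D\<phi> v) = v" for v
  proof -
    have "((\<lambda>y. \<psi> (\<phi> y)) has_derivative (\<lambda>v. D\<psi> (D\<phi> v))) (at x)"
      using has_derivative_compose[OF der\<phi>] der\<psi> by (simp add: a_def)
    moreover have "((\<lambda>y. \<psi> (\<phi> y)) has_derivative (\<lambda>v. v)) (at x)"
      by (rule has_derivative_transform_within_open[OF has_derivative_ident U(1,2)])
        (simp add: inv(1))
    ultimately show ?thesis
      using has_derivative_unique by metis
  qed
  have "tangent_space M x = D\<psi> ` L"
  proof (intro subset_antisym subsetI)
    fix v assume "v \<in> tangent_space M x"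
    then obtain c e where e: "0 < e" and c: "c ` {-e<..<e} \<subseteq> M" "c 0 = x"
      and v: "(c has_vector_derivative v) (at (0::real))"
      unfolding tangent_space_def mem_Collect_eq by (elim exE conjE)
    have "((\<lambda>t. \<phi> (c t)) has_derivative (\<lambda>t. D\<phi> (t *\<^sub>R v))) (at 0)"
      using has_derivative_compose[of c "\<lambda>t. t *\<^sub>R v" 0 UNIV \<phi> D\<phi>] v der\<phi> c(2)
      by (simp add: has_vector_derivative_def)
    then have "((\<lambda>t. \<phi> (c t)) has_vector_derivative D\<phi> v) (at 0)"
      using has_derivative_linear[OF der\<phi>]
      by (simp add: has_vector_derivative_def linear_scale)
    then have lim: "((\<lambda>h. (\<phi> (c (0 + h)) - \<phi> (c 0)) /\<^sub>R h) \<longlongrightarrow> D\<phi> v) (at 0)"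
      by (rule has_vector_derivative_imp_tendsto_slope)
    have ev: "\<forall>\<^sub>F h in at 0. (\<phi> (c (0 + h)) - \<phi> (c 0)) /\<^sub>R h \<in> L"
    proof -
      have "isCont c 0"
        using v by (rule has_vector_derivative_continuous)
      then have "\<forall>\<^sub>F h in at 0. c h \<in> U"
        using topological_tendstoD[of c "c 0" "at 0" U] U(1,2) c(2) by (simp add: isCont_def)
      moreover have "\<forall>\<^sub>F h in at (0::real). h \<in> {-e<..<e}"
        using e by (intro eventually_at_in_open') auto
      ultimately show ?thesis
      proof eventually_elim
        case (elim h)
        then have "c h \<in> U \<inter> M" using c(1) by auto
        then have "\<phi> (c h) \<in> L" using L(2) by blast
        moreover have "\<phi> (c 0) \<in> L" using a c(2) by (simp add: a_def)
        ultimately show ?case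
          unfolding add_0 by (intro subspace_scale[OF L(1)] subspace_diff[OF L(1)])
      qed
    qed
    have "D\<phi> v \<in> L"
      by (rule Lim_in_closed_set[OF closed_subspace[OF L(1)] ev at_neq_bot lim])
    then show "v \<in> D\<psi> ` L"
      using inverse by (metis imageI)
  next
    fix v assume "v \<in> D\<psi> ` L"
    then obtain l where l: "l \<in> L" "v = D\<psi> l" by auto
    have "open ((\<lambda>t::real. a + t *\<^sub>R l) -` V)"
      using U(3) by (intro continuous_open_vimage) (auto intro!: continuous_intros)
    moreover have "0 \<in> (\<lambda>t::real. a + t *\<^sub>R l) -` V"
      using a by simp
    ultimately obtain e where e: "0 < e" "ball 0 e \<subseteq> (\<lambda>t::real. a + t *\<^sub>R l) -` V"
      by (rule openE)
    have I: "a + t *\<^sub>R l \<in> V" if "t \<in> {-e<..<e}" for t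
      using e(2) that by (auto simp: subset_iff dist_real_def abs_less_iff)
    define c where "c t = \<psi> (a + t *\<^sub>R l)" for t :: real
    have "smooth_on {-e<..<e} c"
      using sm(2) I by (auto simp: smooth_on_def c_def[abs_def] intro!: Ck_on_line[of _ V \<psi>])
    moreover have "a + t *\<^sub>R l \<in> L" for t
      using a by (intro subspace_add[OF L(1)] subspace_scale[OF L(1)] l(1)) auto
    then have "c ` {-e<..<e} \<subseteq> M"
      using I chart_mem by (auto simp: c_def)
    moreover have "c 0 = x"
      using inv(1) U(2) by (simp add: c_def a_def)
    moreover have "(c has_vector_derivative v) (at 0)"
    proof -
      have "((\<lambda>t::real. a + t *\<^sub>R l) has_derivative (\<lambda>t. t *\<^sub>R l)) (at 0)"
        by (auto intro!: derivative_eq_intros)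
      from has_derivative_compose[OF this, of \<psi> D\<psi>] der\<psi>
      have "(c has_derivative (\<lambda>t. D\<psi> (t *\<^sub>R l))) (at 0)"
        by (simp add: c_def[abs_def])
      then show ?thesis
        using has_derivative_linear[OF der\<psi>] by (simp add: has_vector_derivative_def l(2) linear_scale)
    qed
    ultimately show "v \<in> tangent_space M x"
      using e(1) unfolding tangent_space_def mem_Collect_eq
      by (intro exI[of _ c] exI[of _ e] conjI)
  qed
  then show ?thesis
    using linear_subspace_image[OF has_derivative_linear[OF der\<psi>] L(1)] by simp
qed

lemma orth_proj_eqI:
  assumes "p \<in> T" "\<And>v. v \<in> T \<Longrightarrow> orthogonal (u - p) v"
  shows "orth_proj T u = p"
  unfolding orth_proj_def
proof (rule the_equality)
  show "p \<in> T \<and> (\<forall>v\<in>T. orthogonal (u - p) v)" using assms by blast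
next
  fix q assume q: "q \<in> T \<and> (\<forall>v\<in>T. orthogonal (u - q) v)"
  then have "(p - q) \<bullet> p = 0" "(p - q) \<bullet> q = 0"
    using assms by (auto simp: orthogonal_def inner_diff_left)
  then have "(p - q) \<bullet> (p - q) = 0"
    by (simp add: inner_diff_right)
  then show "q = p" by simp
qed

text \<open>Only for a subspace is the description behind \<open>orth_proj\<close> guaranteed to be met, so this is where
  the linearity of tangent spaces enters: the step size \<open>\<gamma>\<close> can be moved inside the projection.\<close>

lemma
  fixes T :: "'a::euclidean_space set"
  assumes T: "subspace T"
  shows orth_proj_mem: "orth_proj T u \<in> T"
    and orth_proj_scale: "orth_proj T (c *\<^sub>R u) = c *\<^sub>R orth_proj T u"
proof -
  have "\<exists>p. p \<in> T \<and> (\<forall>v\<in>T. orthogonal (u - p) v)"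
  proof -
    obtain y z where "y \<in> span T" "\<And>w. w \<in> span T \<Longrightarrow> orthogonal z w" "u = y + z"
      using orthogonal_subspace_decomp_exists[of T u] by metis
    moreover have "span T = T" using T by (simp add: span_eq_iff)
    ultimately show ?thesis by (intro exI[of _ y]) auto
  qed
  then obtain p where p: "p \<in> T" "\<And>v. v \<in> T \<Longrightarrow> orthogonal (u - p) v" by blast
  have u: "orth_proj T u = p" using p by (rule orth_proj_eqI)
  then show "orth_proj T u \<in> T" using p by simp
  show "orth_proj T (c *\<^sub>R u) = c *\<^sub>R orth_proj T u"
    unfolding u
  proof (rule orth_proj_eqI)
    show "c *\<^sub>R p \<in> T" using T p(1) by (rule subspace_scale)
    show "orthogonal (c *\<^sub>R u - c *\<^sub>R p) v" if "v \<in> T" for v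
      using p(2)[OF that] by (simp add: orthogonal_def flip: scaleR_diff_right)
  qed
qed

section \<open>Averaging by a doubly stochastic matrix\<close>

text \<open>Eigenvectors of distinct eigenvalues are orthogonal, hence independent.  Finiteness matters for
  \<open>singular_values\<close>, because \<open>sorted_list_of_set\<close> returns the empty list on infinite sets.\<close>

lemma finite_eigenvalues_symmetric:
  fixes B :: "real^'n^'n"
  assumes sym: "transpose B = B"
  shows "finite {a. eigenvalue B a}"
proof -
  have "\<forall>a\<in>{a. eigenvalue B a}. \<exists>v. v \<noteq> 0 \<and> B *v v = a *\<^sub>R v"
    by (auto simp: eigenvalue_def)
  then obtain v where v: "\<And>a. eigenvalue B a \<Longrightarrow> v a \<noteq> 0" "\<And>a. eigenvalue B a \<Longrightarrow> B *v v a = a *\<^sub>R v a"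
    using bchoice[of "{a. eigenvalue B a}" "\<lambda>a v. v \<noteq> 0 \<and> B *v v = a *\<^sub>R v"] by blast
  have orth: "v a \<bullet> v b = 0" if "eigenvalue B a" "eigenvalue B b" "a \<noteq> b" for a b
  proof -
    have "(B *v v a) \<bullet> v b = v a \<bullet> (B *v v b)"
      by (metis dot_lmul_matrix sym vector_transpose_matrix)
    then have "(a - b) * (v a \<bullet> v b) = 0"
      using that v(2) by (simp add: algebra_simps)
    then show ?thesis using that(3) by simp
  qed
  have "inj_on v {a. eigenvalue B a}"
    using orth v(1) by (auto intro!: inj_onI) (metis inner_eq_zero_iff)
  moreover have "independent (v ` {a. eigenvalue B a})"
  proof (rule pairwise_orthogonal_independent)
    show "pairwise orthogonal (v ` {a. eigenvalue B a})"
      using orth by (auto simp: pairwise_def orthogonal_def)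
    show "0 \<notin> v ` {a. eigenvalue B a}"
      using v(1) by force
  qed
  then have "finite (v ` {a. eigenvalue B a})"
    by (rule finiteI_independent)
  ultimately show ?thesis
    using finite_imageD by blast
qed

lemma finite_singular_value_set:
  "finite {s. 0 \<le> s \<and> eigenvalue (transpose A ** A) (s\<^sup>2)}"
proof -
  have "finite ((\<lambda>s. s\<^sup>2) ` {s. 0 \<le> s \<and> eigenvalue (transpose A ** A) (s\<^sup>2)})"
    by (rule finite_subset[OF _ finite_eigenvalues_symmetric[of "transpose A ** A"]])
      (auto simp: matrix_transpose_mul)
  moreover have "inj_on (\<lambda>s. s\<^sup>2) {s::real. 0 \<le> s \<and> eigenvalue (transpose A ** A) (s\<^sup>2)}"
    by (auto simp: inj_on_def)
  ultimately show ?thesis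
    by (rule finite_imageD)
qed

lemma sorted_concat_replicate:
  assumes "sorted_wrt (\<ge>) (xs :: 'a::linorder list)"
  shows "sorted_wrt (\<ge>) (concat (map (\<lambda>s. replicate (f s) s) xs))"
proof -
  have "sorted_wrt (\<ge>) (replicate n a)" for n and a :: 'a
    by (induction n) auto
  then show ?thesis
    using assms by (induction xs) (auto simp: sorted_wrt_append)
qed

lemma sorted_desc_second_ge:
  fixes xs :: "'a::linorder list"
  assumes "sorted_wrt (\<ge>) xs" "2 \<le> length (filter ((\<le>) m) xs)"
  shows "m \<le> xs ! 1"
proof -
  obtain a b ys where xs: "xs = a # b # ys"
    using assms(2) by (cases xs; cases "tl xs") (auto split: if_splits)
  show ?thesis
  proof (rule ccontr)
    assume "\<not> m \<le> xs ! 1"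
    then have "filter ((\<le>) m) (b # ys) = []"
      using assms(1) xs by (auto simp: filter_empty_conv)
    then show False
      using assms(2) xs by (auto split: if_splits)
  qed
qed

text \<open>Two orthogonal eigenvectors occupy two positions of the list of singular values: two copies in one
  eigenspace if the singular values agree, and one copy in each of two eigenspaces otherwise.  Both
  entries are at least \<open>min s t\<close>, and the list is decreasing, so its second entry is as well.\<close>

lemma second_singular_value_ge:
  fixes A :: "real^'n^'n"
  assumes u: "u \<noteq> 0" "(transpose A ** A) *v u = s\<^sup>2 *\<^sub>R u" "0 \<le> s"
    and v: "v \<noteq> 0" "(transpose A ** A) *v v = t\<^sup>2 *\<^sub>R v" "0 \<le> t"
    and uv: "orthogonal u v"
  shows "min s t \<le> second_singular_value A"
proof -
  define S where "S = {s. 0 \<le> s \<and> eigenvalue (transpose A ** A) (s\<^sup>2)}"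
  define E where "E s = {v. (transpose A ** A) *v v = s\<^sup>2 *\<^sub>R v}" for s
  define m where "m = min s t"
  have fin: "finite S"
    unfolding S_def by (rule finite_singular_value_set)
  have st: "s \<in> S" "t \<in> S"
    using u v by (auto simp: S_def eigenvalue_def)
  have count: "length (filter ((\<le>) m) (concat (map (\<lambda>s. replicate (dim (E s)) s) xs)))
      = (\<Sum>s\<leftarrow>xs. if m \<le> s then dim (E s) else 0)" for xs
    by (induction xs) auto
  have "(\<Sum>s\<leftarrow>rev (sorted_list_of_set S). if m \<le> s then dim (E s) else 0)
      = (\<Sum>s\<in>S. if m \<le> s then dim (E s) else 0)"
    using fin by (subst sum_list_distinct_conv_sum_set) auto
  moreover have "2 \<le> (\<Sum>s\<in>S. if m \<le> s then dim (E s) else 0)"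
  proof (cases "s = t")
    case True
    have "u \<noteq> v" using uv u(1) by (auto simp: orthogonal_def)
    have "independent {u, v}"
      using uv u(1) v(1) by (intro pairwise_orthogonal_independent)
        (auto simp: pairwise_def orthogonal_commute)
    then have "2 \<le> dim (E s)"
      using independent_card_le_dim[of "{u, v}" "E s"] u v True \<open>u \<noteq> v\<close> by (auto simp: E_def)
    also have "\<dots> = (\<Sum>s\<in>{s}. if m \<le> s then dim (E s) else 0)"
      by (simp add: m_def)
    also have "\<dots> \<le> (\<Sum>s\<in>S. if m \<le> s then dim (E s) else 0)"
      using fin st by (intro sum_mono2) auto
    finally show ?thesis .
  next
    case False
    have one: "1 \<le> dim (E s)" if "w \<noteq> 0" "w \<in> E s" for s w
      using independent_card_le_dim[of "{w}" "E s"] that by auto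
    have "2 \<le> dim (E s) + dim (E t)"
      using one[of u s] one[of v t] u v by (auto simp: E_def)
    also have "\<dots> = (\<Sum>s\<in>{s,t}. if m \<le> s then dim (E s) else 0)"
      using False by (simp add: m_def)
    also have "\<dots> \<le> (\<Sum>s\<in>S. if m \<le> s then dim (E s) else 0)"
      using fin st by (intro sum_mono2) auto
    finally show ?thesis .
  qed
  ultimately have "2 \<le> length (filter ((\<le>) m) (singular_values A))"
    unfolding singular_values_def S_def[symmetric] E_def[symmetric] count by simp
  moreover have "sorted_wrt (\<ge>) (singular_values A)"
    unfolding singular_values_def
    by (rule sorted_concat_replicate) (simp add: sorted_wrt_rev)
  ultimately show ?thesis
    unfolding second_singular_value_def m_def by (intro sorted_desc_second_ge)
qed

text \<open>The spectral theorem in the only form required below.  A unit vector \<open>e\<close> maximizing \<open>norm (A *v e)\<close>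
  exists by compactness.  The residual \<open>c = (transpose A ** A) *v e - s\<^sup>2 *\<^sub>R e\<close> lies in the invariant
  subspace, and maximality along \<open>e + t c\<close> gives \<open>2 t (norm c)\<^sup>2 \<le> t\<^sup>2 D\<close> for a constant \<open>D\<close> and all
  \<open>t\<close>, which forces \<open>c = 0\<close>.\<close>

lemma rayleigh_maximizer_on_invariant_subspace:
  fixes A :: "real^'n^'n"
  assumes T: "subspace T" "T \<noteq> {0}" and inv: "\<And>v. v \<in> T \<Longrightarrow> (transpose A ** A) *v v \<in> T"
  obtains e where "e \<in> T" "norm e = 1" "(transpose A ** A) *v e = (norm (A *v e))\<^sup>2 *\<^sub>R e"
    and "\<And>v. v \<in> T \<Longrightarrow> norm (A *v v) \<le> norm (A *v e) * norm v"
proof -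
  obtain w where w: "w \<in> T" "w \<noteq> 0"
    using T subspace_0 by blast
  have "compact (sphere 0 1 \<inter> T)"
    using T(1) by (intro compact_Int_closed closed_subspace) auto
  moreover have "(1 / norm w) *\<^sub>R w \<in> sphere 0 1 \<inter> T"
    using w T(1) by (auto simp: subspace_scale)
  then have "sphere 0 1 \<inter> T \<noteq> {}" by blast
  moreover have "continuous_on (sphere 0 1 \<inter> T) (\<lambda>v. norm (A *v v))"
    by (intro continuous_intros linear_continuous_on_compose[OF continuous_on_id]
        matrix_vector_mul_linear)
  ultimately obtain e where e: "e \<in> sphere 0 1 \<inter> T"
    "\<And>v. v \<in> sphere 0 1 \<inter> T \<Longrightarrow> norm (A *v v) \<le> norm (A *v e)"
    using continuous_attains_sup by (metis (no_types, lifting))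
  define s where "s = norm (A *v e)"
  define B where "B = transpose A ** A"
  have max: "norm (A *v v) \<le> s * norm v" if "v \<in> T" for v
  proof (cases "v = 0")
    case False
    then have "norm (A *v ((1 / norm v) *\<^sub>R v)) \<le> s"
      using e(2)[of "(1 / norm v) *\<^sub>R v"] that T(1) by (simp add: s_def subspace_scale)
    then show ?thesis
      using False by (simp add: scaleR_matrix_vector_assoc[symmetric] matrix_vector_mult_scaleR field_simps)
  qed simp
  have quad: "(A *v a) \<bullet> (A *v b) = (B *v a) \<bullet> b" for a b
    by (metis B_def dot_lmul_matrix inner_commute matrix_vector_mul_assoc vector_transpose_matrix)
  define c where "c = B *v e - s\<^sup>2 *\<^sub>R e"
  have cT: "c \<in> T"
    using e(1) inv T(1) by (auto simp: c_def B_def subspace_diff subspace_scale)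
  define D where "D = s\<^sup>2 * (norm c)\<^sup>2 - (norm (A *v c))\<^sup>2"
  have "2 * t * (norm c)\<^sup>2 \<le> t\<^sup>2 * D" for t
  proof -
    have "e + t *\<^sub>R c \<in> T" using e(1) cT T(1) by (auto simp: subspace_add subspace_scale)
    then have "(norm (A *v (e + t *\<^sub>R c)))\<^sup>2 \<le> (s * norm (e + t *\<^sub>R c))\<^sup>2"
      using max by (intro power_mono) auto
    moreover have "(norm (A *v (e + t *\<^sub>R c)))\<^sup>2
        = s\<^sup>2 + 2 * t * ((B *v e) \<bullet> c) + t\<^sup>2 * (norm (A *v c))\<^sup>2"
      unfolding s_def quad[symmetric] power2_norm_eq_inner matrix_vector_right_distrib matrix_vector_mult_scaleR
      by (simp add: inner_add_left inner_add_right inner_commute power2_eq_square algebra_simps)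
    moreover have "(s * norm (e + t *\<^sub>R c))\<^sup>2 = s\<^sup>2 * (1 + 2 * t * (e \<bullet> c) + t\<^sup>2 * (norm c)\<^sup>2)"
    proof -
      have "(norm (e + t *\<^sub>R c))\<^sup>2 = (norm e)\<^sup>2 + 2 * t * (e \<bullet> c) + t\<^sup>2 * (norm c)\<^sup>2"
        unfolding power2_norm_eq_inner
        by (simp add: inner_add_left inner_add_right inner_commute power2_eq_square algebra_simps)
      then show ?thesis using e(1) by (simp add: power_mult_distrib)
    qed
    ultimately have "s\<^sup>2 + 2 * t * ((B *v e) \<bullet> c) + t\<^sup>2 * (norm (A *v c))\<^sup>2
        \<le> s\<^sup>2 * (1 + 2 * t * (e \<bullet> c) + t\<^sup>2 * (norm c)\<^sup>2)"
      by metis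
    moreover have "(B *v e) \<bullet> c = (norm c)\<^sup>2 + s\<^sup>2 * (e \<bullet> c)"
      by (simp add: power2_norm_eq_inner c_def inner_diff_left)
    ultimately show ?thesis
      by (simp add: D_def algebra_simps)
  qed
  note small = this
  have "(norm c)\<^sup>2 = 0"
  proof (rule ccontr)
    assume nz: "(norm c)\<^sup>2 \<noteq> 0"
    \<comment> \<open>Any step size below \<open>2 (norm c)\<^sup>2 / D\<close> is contradictory; the shift by 1 avoids dividing by 0.\<close>
    define q where "q = \<bar>D\<bar> + 1"
    have q: "0 < q" "D \<le> q" by (auto simp: q_def)
    define N where "N = (norm c)\<^sup>2"
    have N: "0 < N" using nz by (simp add: N_def)
    have "2 * (N / q) * N \<le> (N / q)\<^sup>2 * D"
      using small[of "N / q"] by (simp add: N_def)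
    also have "\<dots> \<le> (N / q)\<^sup>2 * q"
      using q by (intro mult_left_mono) auto
    also have "\<dots> = (N / q) * N"
      using q by (simp add: power2_eq_square)
    finally have "(N / q) * N \<le> 0"
      by linarith
    then show False
      using mult_pos_pos[OF divide_pos_pos[OF N q(1)] N] by linarith
  qed
  then have "B *v e = s\<^sup>2 *\<^sub>R e" by (simp add: c_def)
  then show ?thesis
    using that[of e] e(1) max by (auto simp: B_def s_def)
qed

text \<open>On the orthogonal complement of the vector of ones the norm of \<open>W\<close> is a singular value \<open>s\<close>, with
  an eigenvector orthogonal to the vector of ones, which has singular value 1.  Hence
  \<open>min 1 s\<close> is at most the second singular value; since that is smaller than 1, so is \<open>s\<close>, and
  \<open>s\<close> itself is the minimum.\<close>

lemma doubly_stochastic_contraction: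
  fixes W :: "real^'n^'n"
  assumes W: "doubly_stochastic W" 
    and less1: "second_singular_value W < 1"
    and v: "(\<Sum>i\<in>UNIV. v $ i) = 0"
  shows "norm (W *v v) \<le> second_singular_value W * norm v"
proof (cases "v = 0")
  case False
  define T where "T = {v::real^'n. 1 \<bullet> v = 0}"
  have sum: "1 \<bullet> u = (\<Sum>i\<in>UNIV. u $ i)" for u :: "real^'n"
    by (simp add: inner_vec_def)
  have T: "subspace T" "T \<noteq> {0}" "v \<in> T"
    using False v by (auto simp: T_def sum[symmetric] subspace_hyperplane)
  have W1: "W *v 1 = 1" "transpose W *v 1 = 1"
    using W by (auto simp: doubly_stochastic_def vec_eq_iff matrix_vector_mult_def transpose_def)
  have B1: "(transpose W ** W) *v 1 = 1"
    using W1 by (simp add: matrix_vector_mul_assoc[symmetric])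
  have inv: "(transpose W ** W) *v u \<in> T" if "u \<in> T" for u
  proof -
    have "1 \<bullet> ((transpose W ** W) *v u) = ((transpose W ** W) *v 1) \<bullet> u"
      by (metis dot_lmul_matrix matrix_transpose_mul transpose_transpose vector_transpose_matrix)
    then show ?thesis
      using that B1 by (simp add: T_def)
  qed
  obtain e where e: "e \<in> T" "norm e = 1" "(transpose W ** W) *v e = (norm (W *v e))\<^sup>2 *\<^sub>R e"
    and max: "\<And>v. v \<in> T \<Longrightarrow> norm (W *v v) \<le> norm (W *v e) * norm v"
    using rayleigh_maximizer_on_invariant_subspace[OF T(1,2) inv] by blast
  have "min 1 (norm (W *v e)) \<le> second_singular_value W"
    by (rule second_singular_value_ge[of 1 W 1 e])
      (use e B1 in \<open>auto simp: orthogonal_def T_def\<close>)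
  then have "norm (W *v e) \<le> second_singular_value W"
    using less1 by linarith
  then show ?thesis
    using max[OF T(3)] by (meson mult_right_mono norm_ge_zero order_trans)
qed simp

text \<open>The operator \<open>W \<otimes> I\<close>, by which the agents average the values of their neighbours.\<close>

definition mix :: "real^'n^'n \<Rightarrow> 'a::real_vector^'n \<Rightarrow> 'a^'n" where
  "mix W z = (\<chi> i. \<Sum>j\<in>UNIV. W $ i $ j *\<^sub>R z $ j)"

lemma norm_stacked_squared:
  fixes z :: "'a::real_normed_vector^'n"
  shows "(norm z)\<^sup>2 = (\<Sum>i\<in>UNIV. (norm (z $ i))\<^sup>2)"
  by (simp add: norm_vec_def L2_set_def sum_nonneg)

text \<open>Averaging acts on each coordinate of the values separately, so the bound for real vectors carries
  over to stacked variables with centred entries.\<close>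

lemma mix_contraction:
  fixes z :: "'a::euclidean_space^'n"
  assumes W: "doubly_stochastic W" 
    and \<sigma>: "0 \<le> second_singular_value W" "second_singular_value W < 1"
    and z: "(\<Sum>i\<in>UNIV. z $ i) = 0"
  shows "norm (mix W z) \<le> second_singular_value W * norm z"
proof -
  define \<sigma> where "\<sigma> = second_singular_value W"
  define c where "c b z = (\<chi> i. (z $ i) \<bullet> b)" for b :: 'a and z :: "'a^'n"
  have split: "(norm z)\<^sup>2 = (\<Sum>b\<in>Basis. (norm (c b z))\<^sup>2)" for z
  proof -
    have "(norm y)\<^sup>2 = (\<Sum>b\<in>Basis. (y \<bullet> b)\<^sup>2)" for y :: 'a
      by (simp only: power2_norm_eq_inner euclidean_inner[of y y] power2_eq_square[of "y \<bullet> _"])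
    then have "(norm z)\<^sup>2 = (\<Sum>i\<in>UNIV. \<Sum>b\<in>Basis. (z $ i \<bullet> b)\<^sup>2)"
      by (simp only: norm_stacked_squared)
    also have "\<dots> = (\<Sum>b\<in>Basis. \<Sum>i\<in>UNIV. (z $ i \<bullet> b)\<^sup>2)"
      by (rule sum.swap)
    finally show ?thesis
      by (simp add: norm_stacked_squared c_def)
  qed
  have comm: "c b (mix W z) = W *v c b z" for b
    by (simp add: c_def mix_def vec_eq_iff matrix_vector_mult_def inner_sum_left)
  have "(norm (mix W z))\<^sup>2 \<le> (\<Sum>b\<in>Basis. (\<sigma> * norm (c b z))\<^sup>2)"
    unfolding split comm
  proof (intro sum_mono power_mono norm_ge_zero)
    fix b :: 'a assume "b \<in> Basis"
    have "(\<Sum>i\<in>UNIV. c b z $ i) = 0"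
      using z by (simp add: c_def flip: inner_sum_left)
    then show "norm (W *v c b z) \<le> \<sigma> * norm (c b z)"
      unfolding \<sigma>_def by (rule doubly_stochastic_contraction[OF W \<sigma>(2)])
  qed
  also have "\<dots> = (\<sigma> * norm z)\<^sup>2"
    by (simp add: power_mult_distrib split flip: sum_distrib_left)
  finally show ?thesis
    unfolding \<sigma>_def by (rule power2_le_imp_le) (use \<sigma> in simp)
qed

section \<open>Distance of stacked variables to consensus\<close>

lemma sum_stacked_mean:
  fixes x :: "'a::real_vector^'n"
  shows "(\<Sum>i\<in>UNIV. x $ i) = real CARD('n) *\<^sub>R agent_mean x"
  by (simp add: agent_mean_def)

text \<open>The decomposition of the second moment about \<open>c\<close> into variance and squared bias; the cross term
  vanishes because deviations from the mean sum to zero.\<close>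

lemma norm_stacked_split:
  fixes x :: "'a::euclidean_space^'n"
  shows "(norm (x - stack c))\<^sup>2 = (norm (x - stack (agent_mean x)))\<^sup>2
           + real CARD('n) * (norm (agent_mean x - c))\<^sup>2"
proof -
  define m where "m = agent_mean x"
  have "(norm (x $ i - c))\<^sup>2 = (norm (x $ i - m))\<^sup>2 + 2 * ((x $ i - m) \<bullet> (m - c)) + (norm (m - c))\<^sup>2" for i
    by (simp add: power2_norm_eq_inner inner_diff_left inner_diff_right inner_commute)
  then have "(norm (x - stack c))\<^sup>2 = (\<Sum>i\<in>UNIV. (norm (x $ i - m))\<^sup>2)
      + 2 * ((\<Sum>i\<in>UNIV. x $ i - m) \<bullet> (m - c)) + real CARD('n) * (norm (m - c))\<^sup>2"
    by (simp add: norm_stacked_squared stack_def sum.distrib inner_sum_left sum_distrib_left)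
  moreover have "(\<Sum>i\<in>UNIV. x $ i - m) = 0"
    by (simp add: sum_subtractf sum_stacked_mean m_def sum_constant_scaleR)
  ultimately show ?thesis
    by (simp add: norm_stacked_squared stack_def m_def)
qed

lemma norm_sub_mean_le:
  fixes x :: "'a::euclidean_space^'n"
  shows "norm (x - stack (agent_mean x)) \<le> norm (x - stack c)"
  by (rule power2_le_imp_le) (simp_all add: norm_stacked_split[of x c])

text \<open>By the decomposition, minimizing \<open>norm (x - stack c)\<close> over \<open>c \<in> M\<close> is the same as minimizing the
  distance of \<open>c\<close> to the mean.  This lets the next projected mean be replaced by any point of \<open>M\<close>, in
  particular by the present one.\<close>

lemma nearest_point_minimizes_stacked:
  fixes x :: "'a::euclidean_space^'n"
  assumes "p \<in> nearest_points M (agent_mean x)" "c \<in> M"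
  shows "norm (x - stack p) \<le> norm (x - stack c)"
proof (rule power2_le_imp_le)
  have "norm (agent_mean x - p) \<le> norm (agent_mean x - c)"
    using assms by (auto simp: nearest_points_def dist_norm norm_minus_commute)
  then show "(norm (x - stack p))\<^sup>2 \<le> (norm (x - stack c))\<^sup>2"
    unfolding norm_stacked_split[of x p] norm_stacked_split[of x c]
    by (intro add_left_mono mult_left_mono power_mono) auto
qed simp

lemma infdist_consensus_set:
  fixes x :: "'a::euclidean_space^'n"
  assumes "p \<in> nearest_points M (agent_mean x)"
  shows "infdist x (consensus_set M) = norm (x - stack p)"
proof -
  have eq: "consensus_set M = (stack ` M :: ('a^'n) set)"
  proof (intro subset_antisym subsetI)
    fix z :: "'a^'n" assume z: "z \<in> consensus_set M"
    \<comment> \<open>All entries agree, so any index will do.\<close>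
    then have "z = stack (z $ undefined)" "z $ undefined \<in> M"
      by (auto simp: consensus_set_def stack_def vec_eq_iff)
    then show "z \<in> stack ` M" by blast
  qed (auto simp: consensus_set_def stack_def)
  have p: "p \<in> M" using assms by (simp add: nearest_points_def)
  show ?thesis
    unfolding eq
  proof (rule antisym)
    show "infdist x (stack ` M) \<le> norm (x - stack p)"
      using infdist_le[of "stack p" "stack ` M" x] p by (simp add: dist_norm)
    have "stack ` M \<noteq> {}" using p by auto
    then show "norm (x - stack p) \<le> infdist x (stack ` M)"
      using nearest_point_minimizes_stacked[OF assms]
      by (auto simp: infdist_notempty dist_norm intro!: cINF_greatest)
  qed
qed

text \<open>The 2-norm of the vector of squares is at most its 1-norm, which is the squared norm.\<close>

lemma norm_vec_of_squares_le:
  fixes u :: "'a::real_normed_vector^'n" and z :: "'b::real_normed_vector^'n"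
  assumes "\<And>i. norm (z $ i) \<le> K * (norm (u $ i))\<^sup>2"
  shows "norm z \<le> K * (norm u)\<^sup>2"
proof -
  have "norm z \<le> (\<Sum>i\<in>UNIV. norm (z $ i))"
    unfolding norm_vec_def by (rule L2_set_le_sum) simp
  also have "\<dots> \<le> (\<Sum>i\<in>UNIV. K * (norm (u $ i))\<^sup>2)"
    using assms by (rule sum_mono)
  finally show ?thesis
    by (simp add: norm_stacked_squared sum_distrib_left)
qed

lemma norm_vec_scaled_le:
  fixes u :: "'a::real_normed_vector^'n" and z :: "'b::real_normed_vector^'n"
  assumes "\<And>i. norm (z $ i) \<le> K * norm (u $ i)" "0 \<le> K"
  shows "norm z \<le> K * norm u"
proof -
  have "norm z \<le> L2_set (\<lambda>i. K * norm (u $ i)) UNIV"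
    unfolding norm_vec_def using assms by (intro L2_set_mono) auto
  then show ?thesis
    using assms(2) by (simp add: norm_vec_def L2_set_right_distrib)
qed

text \<open>After multiplication by \<open>R - \<delta>\<close> the claim says that the quadratic polynomial
  \<open>K \<delta>\<^sup>2 - (K R + 1) \<delta> + R (1 - a)\<close> is positive, and the bound on \<open>\<delta>\<close> is its smaller root: the
  discriminant is \<open>(K R + 1)\<^sup>2 - 4 K R (1 - a) = (K R - 1)\<^sup>2 + 4 K R a\<close>.\<close>

lemma rate_lt_1:
  fixes K R a \<delta> :: real
  assumes "0 < K" "0 < R" "\<delta> < R"
    and \<delta>: "\<delta> < (K * R + 1 - sqrt ((K * R - 1)\<^sup>2 + 4 * K * R * a)) / (2 * K)"
  shows "R * a / (R - \<delta>) + K * \<delta> < 1"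
proof -
  define D where "D = (K * R - 1)\<^sup>2 + 4 * K * R * a"
  have s: "sqrt D < K * R + 1 - 2 * K * \<delta>"
    using \<delta> assms(1) by (simp add: D_def field_simps)
  have "D < (K * R + 1 - 2 * K * \<delta>)\<^sup>2"
  proof (cases "0 \<le> K * R + 1 - 2 * K * \<delta>")
    case True
    then show ?thesis
      using s real_sqrt_less_iff[of D "(K * R + 1 - 2 * K * \<delta>)\<^sup>2"] by simp
  next
    case False
    then have "sqrt D < 0"
      using s by linarith
    then have "D < 0"
      by simp
    then show ?thesis
      by (rule less_le_trans) simp
  qed
  then have "0 < 4 * K * (K * \<delta>\<^sup>2 - (K * R + 1) * \<delta> + R * (1 - a))"
    by (simp add: D_def power2_eq_square algebra_simps)
  then have "0 < K * \<delta>\<^sup>2 - (K * R + 1) * \<delta> + R * (1 - a)"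
    using assms(1) by (simp add: zero_less_mult_iff)
  then show ?thesis
    using assms(3) by (simp add: field_simps power2_eq_square)
qed

section \<open>Linear convergence to consensus\<close>

text \<open>One step of the method.  The new iterate is compared with the old projected mean \<open>c\<close>, passing
  through the exact projections \<open>p i\<close> of the points \<open>x $ i + u $ i\<close>, where \<open>u\<close> is the consensus step
  in the ambient space.  The points \<open>p i\<close> and \<open>c\<close> are the projections of \<open>x $ i + u $ i\<close> and of the
  mean, all within distance \<open>\<delta>\<close> of \<open>M\<close>, so the Lipschitz bound reduces their distance to that of
  the averaged variables, which averaging contracts.  The retraction differs from the projection by
  at most \<open>M1 * (norm u)\<^sup>2\<close>, of second order in the consensus error; one factor of that error is
  bounded by \<open>\<delta>\<close>.\<close>

lemma retraction_step:
  fixes M :: "'a::euclidean_space set" and x x' :: "'a^'n" and W :: "real^'n^'n"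
  assumes M: "compact M" "proximally_smooth R M"
    and T: "\<And>p. p \<in> M \<Longrightarrow> subspace (tangent_space M p)"
    and Rt: "retraction_constant M Rt M1"
    and W: "doubly_stochastic W" "0 \<le> second_singular_value W" "second_singular_value W < 1"
    and \<gamma>: "0 < \<gamma>" "\<gamma> \<le> 1"
    and step: "\<And>i. x' $ i = Rt (x $ i) (- (\<gamma> *\<^sub>R orth_proj (tangent_space M (x $ i)) (x $ i - mix W x $ i)))"
    and x: "\<And>i. x $ i \<in> M"
    and c: "c \<in> nearest_points M (agent_mean x)" "norm (x - stack c) \<le> \<delta>" "\<delta> < R"
    and c': "c' \<in> nearest_points M (agent_mean x')"
  shows "norm (x' - stack c')
    \<le> (R * (1 - \<gamma> + \<gamma> * second_singular_value W) / (R - \<delta>) + 4 * M1 * \<gamma>\<^sup>2 * \<delta>) * norm (x - stack c)"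
proof -
  define \<sigma> where "\<sigma> = second_singular_value W"
  define m where "m = agent_mean x"
  define e where "e = norm (x - stack c)"
  define z where "z = x - stack m"
  define u where "u = (- \<gamma>) *\<^sub>R (z - mix W z)"
  have R: "0 < R" and M1: "0 < M1" and cM: "c \<in> M"
    using M(2) Rt c by (auto simp: proximally_smooth_def retraction_constant_def nearest_points_def)
  have row: "(\<Sum>j\<in>UNIV. W $ i $ j) = 1" and nonneg: "0 \<le> W $ i $ j" for i j
    using W(1) by (auto simp: doubly_stochastic_def)
  have mix_shift: "mix W (x - stack b) $ i = mix W x $ i - b" for b i
    using row[of i]
    by (simp add: mix_def stack_def scaleR_diff_right sum_subtractf flip: scaleR_sum_left)
  have u: "u $ i = (- \<gamma>) *\<^sub>R (x $ i - mix W x $ i)" for i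
    unfolding u_def z_def by (simp add: mix_shift) (simp add: stack_def)
  have step': "x' $ i = Rt (x $ i) (orth_proj (tangent_space M (x $ i)) (u $ i))" for i
    unfolding step u orth_proj_scale[OF T[OF x]] by simp
  obtain p where p: "\<And>i. p i \<in> nearest_points M (x $ i + u $ i)"
    "\<And>i. norm (p i - x' $ i) \<le> M1 * (norm (u $ i))\<^sup>2"
    proof -
    have "\<forall>i. \<exists>q. q \<in> nearest_points M (x $ i + u $ i) \<and> norm (q - x' $ i) \<le> M1 * (norm (u $ i))\<^sup>2"
      using Rt x unfolding step' retraction_constant_def by blast
    then show ?thesis
      using that by (auto dest!: choice)
  qed
  have dist_xi: "norm (x $ i - c) \<le> \<delta>" for i
    using Finite_Cartesian_Product.norm_nth_le[where x = "x - stack c" and i = i] c(2) by (simp add: stack_def)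
  \<comment> \<open>Each point \<open>x $ i + u $ i\<close> is a convex combination of points within \<open>\<delta>\<close> of \<open>c\<close>.\<close>
  have tube: "infdist (x $ i + u $ i) M \<le> \<delta>" for i
  proof (rule infdist_le2[OF cM])
    have "norm (mix W (x - stack c) $ i) \<le> (\<Sum>j\<in>UNIV. norm (W $ i $ j *\<^sub>R (x $ j - c)))"
      by (simp add: mix_def stack_def sum_norm_le)
    also have "\<dots> \<le> (\<Sum>j\<in>UNIV. W $ i $ j * \<delta>)"
      using dist_xi nonneg by (intro sum_mono) (auto intro!: mult_left_mono)
    also have "\<dots> = \<delta>"
      using row[of i] by (simp flip: sum_distrib_right)
    finally have mixb: "norm (mix W (x - stack c) $ i) \<le> \<delta>" .
    have "x $ i + u $ i - c = (1 - \<gamma>) *\<^sub>R (x $ i - c) + \<gamma> *\<^sub>R mix W (x - stack c) $ i"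
      unfolding u mix_shift by (simp add: algebra_simps)
    also have "norm \<dots> \<le> (1 - \<gamma>) * \<delta> + \<gamma> * \<delta>"
      using dist_xi[of i] mixb \<gamma>
      by (intro order_trans[OF norm_triangle_ineq] add_mono) (auto intro!: mult_left_mono)
    finally show "dist (x $ i + u $ i) c \<le> \<delta>"
      by (simp add: dist_norm algebra_simps)
  qed
  have tube_m: "infdist m M \<le> \<delta>"
  proof (rule infdist_le2[OF cM])
    have "m - c = (1 / real CARD('n)) *\<^sub>R (\<Sum>i\<in>UNIV. x $ i - c)"
      by (simp add: m_def agent_mean_def sum_subtractf scaleR_diff_right sum_constant_scaleR)
    moreover have "norm (\<Sum>i\<in>UNIV. x $ i - c) \<le> real CARD('n) * \<delta>"
      using dist_xi by (rule sum_norm_bound)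
    ultimately show "dist m c \<le> \<delta>"
      by (simp add: dist_norm field_simps)
  qed
  \<comment> \<open>Averaging fixes constant stacks, so the step \<open>u\<close> depends only on the deviations \<open>z\<close> from the mean.\<close>
  have z0: "(\<Sum>i\<in>UNIV. z $ i) = 0"
    by (simp add: z_def stack_def sum_subtractf sum_stacked_mean m_def sum_constant_scaleR)
  have mixz: "norm (mix W z) \<le> \<sigma> * norm z"
    unfolding \<sigma>_def by (rule mix_contraction[OF W z0])
  have ze: "norm z \<le> e"
    unfolding z_def m_def e_def by (rule norm_sub_mean_le)
  have "norm u \<le> \<gamma> * (2 * e)"
  proof -
    have "norm (z - mix W z) \<le> norm z + norm (mix W z)"
      by (rule norm_triangle_ineq4)
    also have "\<dots> \<le> norm z + 1 * norm z"
      using mixz mult_right_mono[of \<sigma> 1 "norm z"] W(3) by (simp add: \<sigma>_def)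
    finally show ?thesis
      using \<gamma> ze by (simp add: u_def)
  qed
  then have u2: "(norm u)\<^sup>2 \<le> 4 * \<gamma>\<^sup>2 * e\<^sup>2"
    using power_mono[of "norm u" "\<gamma> * (2 * e)" 2] by (simp add: power_mult_distrib)
  have zu: "norm (z + u) \<le> (1 - \<gamma> + \<gamma> * \<sigma>) * e"
  proof -
    have "z + u = (1 - \<gamma>) *\<^sub>R z + \<gamma> *\<^sub>R mix W z"
      by (simp add: u_def algebra_simps)
    also have "norm \<dots> \<le> (1 - \<gamma>) * norm z + \<gamma> * (\<sigma> * norm z)"
      using \<gamma> mixz by (intro order_trans[OF norm_triangle_ineq] add_mono) (auto intro!: mult_left_mono)
    also have "\<dots> = (1 - \<gamma> + \<gamma> * \<sigma>) * norm z"
      by (simp add: algebra_simps)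
    also have "\<dots> \<le> (1 - \<gamma> + \<gamma> * \<sigma>) * e"
      using ze \<gamma> W(2) by (intro mult_left_mono) (auto simp: \<sigma>_def)
    finally show ?thesis .
  qed
  have "norm ((\<chi> i. p i) - stack c) \<le> R / (R - \<delta>) * norm (z + u)"
  proof (rule norm_vec_scaled_le)
    show "norm (((\<chi> i. p i) - stack c) $ i) \<le> R / (R - \<delta>) * norm ((z + u) $ i)" for i
      using nearest_points_lipschitz[OF M(2,1) p(1)[of i] c(1) tube[of i] tube_m[unfolded m_def] c(3)]
      by (simp add: z_def stack_def m_def algebra_simps)
    show "0 \<le> R / (R - \<delta>)" using R c(3) by simp
  qed
  also have "\<dots> \<le> R / (R - \<delta>) * ((1 - \<gamma> + \<gamma> * \<sigma>) * e)"
    using zu R c(3) by (intro mult_left_mono) auto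
  finally have first: "norm ((\<chi> i. p i) - stack c) \<le> R * (1 - \<gamma> + \<gamma> * \<sigma>) / (R - \<delta>) * e"
    by simp
  have "norm (x' - (\<chi> i. p i)) \<le> M1 * (norm u)\<^sup>2"
    by (rule norm_vec_of_squares_le) (use p(2) in \<open>simp add: norm_minus_commute\<close>)
  also have "\<dots> \<le> M1 * (4 * \<gamma>\<^sup>2 * e\<^sup>2)"
    using u2 M1 by simp
  also have "\<dots> \<le> M1 * (4 * \<gamma>\<^sup>2 * (\<delta> * e))"
    using M1 c(2) by (intro mult_left_mono) (auto simp: power2_eq_square e_def intro!: mult_right_mono)
  finally have second: "norm (x' - (\<chi> i. p i)) \<le> 4 * M1 * \<gamma>\<^sup>2 * \<delta> * e"
    by (simp add: algebra_simps)
  have "norm (x' - stack c') \<le> norm (x' - stack c)"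
    by (rule nearest_point_minimizes_stacked[OF c' cM])
  also have "\<dots> \<le> norm (x' - (\<chi> i. p i)) + norm ((\<chi> i. p i) - stack c)"
    using norm_triangle_ineq[of "x' - (\<chi> i. p i)" "(\<chi> i. p i) - stack c"] by simp
  also have "\<dots> \<le> 4 * M1 * \<gamma>\<^sup>2 * \<delta> * e + R * (1 - \<gamma> + \<gamma> * \<sigma>) / (R - \<delta>) * e"
    using first second by linarith
  finally show ?thesis
    unfolding e_def \<sigma>_def by (simp only: distrib_right add.commute)
qed

theorem theorem3p6:
  fixes M :: "(real^'r^'d) set"
    and R M1 \<gamma> \<sigma>2 \<delta> \<rho>2 :: real
    and Rt :: "real^'r^'d \<Rightarrow> real^'r^'d \<Rightarrow> real^'r^'d"
    and E :: "'n::finite \<Rightarrow> 'n \<Rightarrow> bool"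
    and W :: "real^'n^'n"
    and x :: "nat \<Rightarrow> (real^'r^'d)^'n"
    and xbar :: "nat \<Rightarrow> real^'r^'d"
  assumes "compact M" and "embedded_submanifold M" and "proximally_smooth R M"
    and "riemannian_retraction M Rt" and "retraction_constant M Rt M1"
    and "mixing_matrix E W" and "\<sigma>2 = second_singular_value W"
    and "0 < \<gamma>" and "\<gamma> \<le> 1"
    and "\<And>k i. x (Suc k) $ i =
           Rt (x k $ i)
              (- (\<gamma> *\<^sub>R orth_proj (tangent_space M (x k $ i))
                        (x k $ i - (\<Sum>j\<in>UNIV. W $ i $ j *\<^sub>R x k $ j))))"
    and "\<And>k. xbar k \<in> nearest_points M (agent_mean (x k))"
    and "x 0 \<in> consensus_nbhd M \<delta>"
    and "0 \<le> \<delta>"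
    and "\<delta> < min ((8 * M1 * \<gamma>\<^sup>2 * R + 1
                    - sqrt ((8 * M1 * \<gamma>\<^sup>2 * R - 1)\<^sup>2 + 32 * M1 * \<gamma>\<^sup>2 * R * (1 - \<gamma> + \<gamma> * \<sigma>2)))
                  / (16 * M1 * \<gamma>\<^sup>2))
                 (R / 4)"
    and "\<rho>2 = R * (1 - \<gamma> + \<gamma> * \<sigma>2) / (R - \<delta>) + 8 * M1 * \<gamma>\<^sup>2 * \<delta>"
  shows "\<rho>2 < 1 \<and> converges_linearly_to x (consensus_set M) \<rho>2 \<and>
         (\<forall>k. norm (x (Suc k) - stack (xbar (Suc k))) \<le> \<rho>2 * norm (x k - stack (xbar k)))"
proof -
  define K where "K = 8 * M1 * \<gamma>\<^sup>2"
  define err where "err k = norm (x k - stack (xbar k))" for k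
  have M1: "0 < M1" using assms(5) by (simp add: retraction_constant_def)
  have R: "0 < R" using assms(3) by (simp add: proximally_smooth_def)
  have \<delta>: "\<delta> < R" using assms(14) R by simp
  have W: "doubly_stochastic W" "0 \<le> second_singular_value W" "second_singular_value W < 1"
    using assms(6) by (auto simp: mixing_matrix_def)
  have T: "subspace (tangent_space M p)" if "p \<in> M" for p
    using tangent_space_subspace assms(2) that by blast
  have rho_lt: "\<rho>2 < 1"
    unfolding assms(15) K_def[symmetric]
    by (rule rate_lt_1) (use assms(14) assms(8) M1 R \<delta> in \<open>simp_all add: K_def algebra_simps\<close>)
  have rho_nonneg: "0 \<le> \<rho>2"
    unfolding assms(15) assms(7) using M1 R \<delta> assms(8,9,13) W(2) by simp
  have inM: "x k $ i \<in> M" for k i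
  proof (induction k arbitrary: i)
    case 0
    then show ?case using assms(12) by (simp add: consensus_nbhd_def)
  next
    case (Suc k)
    have "- (\<gamma> *\<^sub>R orth_proj (tangent_space M (x k $ i)) v) \<in> tangent_space M (x k $ i)" for v
      using T[OF Suc] by (intro subspace_neg subspace_scale orth_proj_mem)
    then show ?case
      unfolding assms(10) using assms(4) Suc by (auto simp: riemannian_retraction_def)
  qed
  \<comment> \<open>The one-step bound needs the iterate to be in the neighbourhood, which a contraction preserves.\<close>
  have decrease: "err (Suc k) \<le> \<rho>2 * err k" if "err k \<le> \<delta>" for k
  proof -
    have "err (Suc k) \<le> (R * (1 - \<gamma> + \<gamma> * second_singular_value W) / (R - \<delta>) + 4 * M1 * \<gamma>\<^sup>2 * \<delta>) * err k"
      unfolding err_def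
      by (rule retraction_step[OF assms(1,3) T assms(5) W assms(8,9) _ inM assms(11) _ \<delta> assms(11)])
        (use assms(10) that in \<open>simp_all add: mix_def err_def\<close>)
    also have "\<dots> \<le> \<rho>2 * err k"
      unfolding assms(15) assms(7) using M1 assms(13)
      by (intro mult_right_mono add_left_mono) (auto simp: err_def)
    finally show ?thesis .
  qed
  have small: "err k \<le> \<delta>" for k
  proof (induction k)
    case 0
    obtain c where "c \<in> nearest_points M (agent_mean (x 0))" "norm (x 0 - stack c) \<le> \<delta>"
      using assms(12) by (auto simp: consensus_nbhd_def)
    then show ?case
      using nearest_point_minimizes_stacked[OF assms(11), of c 0]
      by (auto simp: err_def nearest_points_def)
  next
    case (Suc k)
    have "\<rho>2 * err k \<le> 1 * err k"
      using rho_lt by (intro mult_right_mono) (auto simp: err_def)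
    then show ?case
      using decrease[OF Suc] Suc by linarith
  qed
  have step: "err (Suc k) \<le> \<rho>2 * err k" for k
    using decrease small by blast
  have geometric: "err k \<le> \<rho>2 ^ k * err 0" for k
  proof (induction k)
    case (Suc k)
    then show ?case
      using step[of k] mult_left_mono[OF Suc rho_nonneg] by simp
  qed simp
  have "err \<longlonglongrightarrow> 0"
  proof (rule tendsto_sandwich[OF _ _ tendsto_const])
    show "(\<lambda>k. \<rho>2 ^ k * err 0) \<longlonglongrightarrow> 0"
      using tendsto_mult_left_zero[OF LIMSEQ_power_zero[of \<rho>2], of "err 0"] rho_nonneg rho_lt by simp
  qed (use geometric in \<open>auto simp: err_def\<close>)
  then have "converges_linearly_to x (consensus_set M) \<rho>2"
    using step by (simp add: converges_linearly_to_def infdist_consensus_set[OF assms(11)] err_def[abs_def])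
  then show ?thesis
    using rho_lt step by (simp add: err_def)
qed

end
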